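(* Let $n\geq 1$ and let $Y_n$ be the set of planar binary trees with $n+1$ leaves. For $t\in Y_n$ let $M(t)=(a_1b_1,\dots,a_nb_n)\in\mathbb{R}^n$, where $a_i$ (resp. $b_i$) is the number of leaves on the left (resp. right) side of the $i$th internal vertex of $t$. Then the convex hull in $\mathbb{R}^n$ of the points $M(t)$, $t\in Y_n$, is a realization of the Stasheff polytope (associahedron) $\mathcal{K}^{n-1}$ of dimension $n-1$.
   Context: Planar binary trees: $Y_n$ is the set of planar rooted binary trees with $n+1$ leaves (so $n$ internal vertices, each having exactly a left input and a right input). Label the leaves of $t\in Y_n$ from left to right by $0,1,\dots,n$, and label the internal vertices by $1,\dots,n$ so that the $i$th vertex is the one which falls in between the leaves $i-1$ and $i$ (i.e. leaf $i-1$ is the rightmost leaf of the left subtree at that vertex and leaf $i$ is the leftmost leaf of the right subtree). The number $a_i$ (resp. $b_i$) is the number of leaves of $t$ lying in the left (resp. right) subtree at the $i$th vertex. Stasheff polytope: $\mathcal{K}^{m}$ is the cell complex of dimension $m$ whose $k$-cells ($0\le k\le m$) are in bijection with the planar rooted trees having $m+2$ leaves and $m-k+1$ internal vertices, each internal vertex having at least two inputs. The cell of a tree $t$ is contained in the (closed) cell of a tree $t'$ if and only if $t$ is a refinement of $t'$, i.e. $t'$ can be obtained from $t$ by contracting some (possibly no) internal edges. A convex polytope is a realization of $\mathcal{K}^m$ if it has dimension $m$ and its poset of nonempty faces ordered by inclusion is isomorphic to this poset of planar trees with $m+2$ leaves, where $t\le t'$ iff $t$ is a refinement of $t'$. *)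

theory Defs
  imports "HOL-Analysis.Analysis"
begin

datatype ptree = Leaf | Node "ptree list"

fun leaves :: "ptree \<Rightarrow> nat" where
  "leaves Leaf = 1"
| "leaves (Node ts) = (\<Sum>t\<leftarrow>ts. leaves t)"

fun reduced :: "ptree \<Rightarrow> bool" where
  "reduced Leaf \<longleftrightarrow> True"
| "reduced (Node ts) \<longleftrightarrow> 2 \<le> length ts \<and> (\<forall>t\<in>set ts. reduced t)"

definition planar_trees :: "nat \<Rightarrow> ptree set" where
  "planar_trees k = {t. reduced t \<and> leaves t = k}"

inductive contracts_edge :: "ptree \<Rightarrow> ptree \<Rightarrow> bool" where
  root: "contracts_edge (Node (us @ Node ts # vs)) (Node (us @ ts @ vs))"
| inside: "contracts_edge s t \<Longrightarrow> contracts_edge (Node (us @ s # vs)) (Node (us @ t # vs))"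

text \<open>\<open>refines t t'\<close>: the tree \<open>t'\<close> arises from \<open>t\<close> by contracting some, possibly no,
  internal edges.\<close>

definition refines :: "ptree \<Rightarrow> ptree \<Rightarrow> bool" where
  "refines = contracts_edge\<^sup>*\<^sup>*"

text \<open>The cell of \<open>t\<close> lies in the closed cell of \<open>t'\<close> iff \<open>t\<close> refines \<open>t'\<close>, so the face poset of
  the Stasheff polytope of dimension \<open>m\<close> is \<open>planar_trees (m + 2)\<close> ordered by \<open>refines\<close>.
  The library's \<open>face_of\<close> counts the empty set and the polytope itself as faces.\<close>

definition realizes_stasheff :: "nat \<Rightarrow> 'a::euclidean_space set \<Rightarrow> bool" where
  "realizes_stasheff m P \<longleftrightarrow>
     polytope P \<and> aff_dim P = int m \<and>
     (\<exists>cell. bij_betw cell (planar_trees (m + 2)) {F. F face_of P \<and> F \<noteq> {}} \<and>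
        (\<forall>t\<in>planar_trees (m + 2). \<forall>t'\<in>planar_trees (m + 2).
           refines t t' \<longleftrightarrow> cell t \<subseteq> cell t'))"

fun binary :: "ptree \<Rightarrow> bool" where
  "binary Leaf \<longleftrightarrow> True"
| "binary (Node ts) \<longleftrightarrow> length ts = 2 \<and> (\<forall>t\<in>set ts. binary t)"

definition Y :: "nat \<Rightarrow> ptree set" where
  "Y n = {t. binary t \<and> leaves t = n + 1}"

text \<open>\<open>branches t i\<close> is the pair of left and right subtrees at the \<open>i\<close>th vertex of the binary
  tree \<open>t\<close>, the one falling in between the leaves \<open>i - 1\<close> and \<open>i\<close> when the leaves are numbered
  from 0. The left subtree of the root carries the leaves below \<open>leaves l\<close>, the right subtree
  the others, so that numbers in the right subtree are shifted by \<open>leaves l\<close>. The value is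
  meaningful only for binary \<open>t\<close> and \<open>1 \<le> i < leaves t\<close>.\<close>

fun branches :: "ptree \<Rightarrow> nat \<Rightarrow> ptree \<times> ptree" where
  "branches (Node [l, r]) i =
     (if i < leaves l then branches l i
      else if i = leaves l then (l, r)
      else branches r (i - leaves l))"
| "branches _ _ = undefined"

text \<open>The coordinates of \<open>real ^ 'n\<close> carry no order of their own: \<open>pos j\<close> is the position of the
  coordinate \<open>j\<close>, intended to be a bijection onto \<open>{1..n}\<close>.\<close>

definition M :: "('n::finite \<Rightarrow> nat) \<Rightarrow> ptree \<Rightarrow> real ^ 'n" where
  "M pos t = (\<chi> j. real (leaves (fst (branches t (pos j)))) *
                    real (leaves (snd (branches t (pos j)))))"

end

theory Submission
  imports Defs
begin

text \<open>Record a tree by the intervals of leaves below its internal vertices. A tree is determined by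
  these intervals, and refinement is reverse inclusion of the interval sets. For a binary tree \<open>t\<close> and
  an interval of \<open>k\<close> leaves, the sum of the products \<open>a\<^sub>i b\<^sub>i\<close> over the gaps \<open>i\<close> inside it is at least
  \<open>k choose 2\<close>, with equality iff the interval belongs to \<open>t\<close>. Hence the points of the convex hull
  where equality holds for all intervals of a tree form a face. Conversely, cutting a weight vector
  \<open>w\<close> at its minima, and recursively between them, produces a tree such that \<open>w\<close> is a combination of
  the indicators of its intervals with positive coefficients (except at the root, where the
  functional is constant), so that the face on which \<open>w\<close> is minimal is the one of that tree. The
  dimension is read off from a chain of faces obtained by contracting edges one at a time.\<close>

section \<open>Intervals of leaves and refinement\<close>

abbreviation forest_leaves :: "ptree list \<Rightarrow> nat" where
  "forest_leaves ts \<equiv> (\<Sum>t\<leftarrow>ts. leaves t)"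

abbreviation reduced_forest :: "ptree list \<Rightarrow> bool" where
  "reduced_forest ts \<equiv> (\<forall>t\<in>set ts. reduced t)"

text \<open>A vertex is encoded by \<open>(p, q)\<close> if its leaves are those numbered \<open>p, \<dots>, q - 1\<close>,
  where the first leaf of the forest has number \<open>d\<close>. In a binary tree, the vertices weakly below
  it are then the \<open>i\<close> with \<open>p < i < q\<close>. Leaves are not recorded.\<close>

fun spans :: "nat \<Rightarrow> ptree list \<Rightarrow> (nat \<times> nat) set" where
  "spans d [] = {}"
| "spans d (Leaf # ts) = spans (Suc d) ts"
| "spans d (Node us # ts) =
     insert (d, d + forest_leaves us) (spans d us \<union> spans (d + forest_leaves us) ts)"

lemma finite_spans [simp]: "finite (spans d ts)"
  by (induction d ts rule: spans.induct) auto

lemma leaves_pos: "reduced t \<Longrightarrow> 1 \<le> leaves t"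
proof (induction t rule: leaves.induct)
  case (2 ts)
  then obtain u us where "ts = u # us" by (cases ts) auto
  with 2 show ?case by fastforce
qed simp

lemma length_le_forest_leaves: "reduced_forest ts \<Longrightarrow> length ts \<le> forest_leaves ts"
  by (induction ts) (use leaves_pos in fastforce)+

lemma two_le_forest_leaves: "reduced_forest us \<Longrightarrow> 2 \<le> length us \<Longrightarrow> 2 \<le> forest_leaves us"
  using length_le_forest_leaves le_trans by blast

lemma leaves_eq_1D: "reduced t \<Longrightarrow> leaves t = 1 \<Longrightarrow> t = Leaf"
  using length_le_forest_leaves by (cases t) force+

lemma spans_append: "spans d (us @ vs) = spans d us \<union> spans (d + forest_leaves us) vs"
  by (induction d us rule: spans.induct) (auto simp: add.assoc)

lemma spans_Cons: "spans d (t # ts) = spans d [t] \<union> spans (d + leaves t) ts"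
  using spans_append[of d "[t]" ts] by simp

lemma spans_bounds:
  "reduced_forest ts \<Longrightarrow> (p, q) \<in> spans d ts \<Longrightarrow> d \<le> p \<and> p + 2 \<le> q \<and> q \<le> d + forest_leaves ts"
proof (induction d ts rule: spans.induct)
  case (3 d us ts)
  have "2 \<le> forest_leaves us" using two_le_forest_leaves[of us] 3(3) by simp
  with 3 show ?case by force
qed force+

lemma spans_proper:
  assumes "reduced_forest ts" "2 \<le> length ts"
  shows "(d, d + forest_leaves ts) \<notin> spans d ts"
proof -
  obtain u v vs where ts: "ts = u # v # vs"
    using assms(2) by (cases ts; cases "tl ts") auto
  have "1 \<le> leaves u" "1 \<le> leaves v" using leaves_pos assms(1) ts by auto
  then show ?thesis
    using spans_bounds[of "[u]" d "d + forest_leaves ts" d]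
      spans_bounds[of "v # vs" d "d + forest_leaves ts" "d + leaves u"] assms(1)
    unfolding ts spans_Cons[of d u "v # vs"] by auto
qed

lemma contracts_edge_leaves: "contracts_edge s t \<Longrightarrow> leaves t = leaves s"
  by (induction rule: contracts_edge.induct) auto

lemma contracts_edge_reduced: "contracts_edge s t \<Longrightarrow> reduced s \<Longrightarrow> reduced t"
  by (induction rule: contracts_edge.induct) auto

lemma contracts_edge_spans: "contracts_edge s t \<Longrightarrow> spans d [t] \<subseteq> spans d [s]"
proof (induction arbitrary: d rule: contracts_edge.induct)
  case (root us ts vs)
  then show ?case by (auto simp: spans_append add.assoc)
next
  case (inside s t us vs)
  have "spans d (us @ t # vs) \<subseteq> spans d (us @ s # vs)"
    using inside.IH[of "d + forest_leaves us"] contracts_edge_leaves[OF inside.hyps]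
      spans_Cons[of "d + forest_leaves us" s vs] spans_Cons[of "d + forest_leaves us" t vs]
    by (auto simp: spans_append)
  then show ?case using contracts_edge_leaves[OF inside.hyps] by auto
qed

lemma contracts_edge_Cons:
  "contracts_edge (Node us) (Node vs) \<Longrightarrow> contracts_edge (Node (t # us)) (Node (t # vs))"
  by (erule contracts_edge.cases) (metis append_Cons ptree.inject contracts_edge.intros)+

lemma contract_span:
  assumes "reduced_forest ts" "I \<in> spans d ts"
  shows "\<exists>ts'. contracts_edge (Node ts) (Node ts') \<and> spans d ts' = spans d ts - {I}"
  using assms
proof (induction d ts rule: spans.induct)
  case (2 d ts)
  then show ?case using contracts_edge_Cons by fastforce
next
  case (3 d us ts)
  define e where "e = d + forest_leaves us"
  have red: "reduced_forest us" "2 \<le> length us" "reduced_forest ts" using 3(3) by auto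
  have "2 \<le> forest_leaves us" using two_le_forest_leaves red by blast
  have root: "(d, e) \<notin> spans d us" "(d, e) \<notin> spans e ts"
    using spans_proper[OF red(1,2)] spans_bounds[OF red(3), of d e e] \<open>2 \<le> forest_leaves us\<close>
    unfolding e_def by (blast, linarith)
  have disj: "spans d us \<inter> spans e ts = {}"
    using spans_bounds[OF red(1)] spans_bounds[OF red(3)] by (force simp: e_def)
  have eq: "spans d (Node us # ts) = insert (d, e) (spans d us \<union> spans e ts)" by (simp add: e_def)
  consider "I = (d, e)" | "I \<in> spans d us" | "I \<in> spans e ts" using 3(4) eq by auto
  then show ?case
  proof cases
    case 1
    then have "spans d (us @ ts) = spans d (Node us # ts) - {I}"
      using root by (auto simp: spans_append e_def)
    then show ?thesis using contracts_edge.root[of "[]"] by fastforce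
  next
    case 2
    then obtain us' where us': "contracts_edge (Node us) (Node us')" "spans d us' = spans d us - {I}"
      using 3(1) red by auto
    have "forest_leaves us' = forest_leaves us" using contracts_edge_leaves[OF us'(1)] by simp
    then have "spans d (Node us' # ts) = spans d (Node us # ts) - {I}"
      using us'(2) 2 root disj by (auto simp: e_def)
    then show ?thesis using contracts_edge.inside[OF us'(1), of "[]"] by fastforce
  next
    case 3
    then obtain ts' where ts': "contracts_edge (Node ts) (Node ts')" "spans e ts' = spans e ts - {I}"
      using "3.IH"(2) red unfolding e_def by auto
    have "spans d (Node us # ts') = spans d (Node us # ts) - {I}"
      using ts'(2) 3 root disj by (auto simp: e_def)
    then show ?thesis using contracts_edge_Cons[OF ts'(1)] by blast
  qed
qed simp

lemma spans_inject:
  "reduced_forest ts \<Longrightarrow> reduced_forest ts' \<Longrightarrow> forest_leaves ts = forest_leaves ts' \<Longrightarrow>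
   spans d ts = spans d ts' \<Longrightarrow> ts = ts'"
proof (induction d ts arbitrary: ts' rule: spans.induct)
  case (1 d)
  then show ?case using length_le_forest_leaves[of ts'] by (metis le_zero_eq length_0_conv list.map(1) sum_list.Nil)
next
  case (2 d ts)
  then obtain t' us' where ts': "ts' = t' # us'" by (cases ts') auto
  have "t' = Leaf"
  proof (cases t')
    case (Node vs)
    then have "(d, d + forest_leaves vs) \<in> spans (Suc d) ts" using 2(5) ts' by auto
    then show ?thesis using spans_bounds[of ts] 2(2) by fastforce
  qed
  with 2 ts' show ?case by auto
next
  case (3 d us ts)
  have red: "reduced_forest us" "2 \<le> length us" "reduced_forest ts" using 3(3) by auto
  have "2 \<le> forest_leaves us" using two_le_forest_leaves red by blast
  have root: "(d, d + forest_leaves us) \<in> spans d ts'" using 3(6) by auto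
  obtain t' ts'' where ts': "ts' = t' # ts''" using root by (cases ts') auto
  have red'': "reduced_forest ts''" using 3(4) ts' by auto
  obtain us' where t': "t' = Node us'"
  proof (cases t')
    case Leaf
    then show ?thesis using root ts' spans_bounds[OF red''] by fastforce
  qed
  have red': "reduced_forest us'" "2 \<le> length us'" using 3(4) ts' t' by auto
  have "2 \<le> forest_leaves us'" using two_le_forest_leaves red' by blast
  have root': "(d, d + forest_leaves us') \<in> spans d (Node us # ts)"
    unfolding 3(6) ts' t' by simp
  have "forest_leaves us \<le> forest_leaves us'"
    using root \<open>2 \<le> forest_leaves us'\<close> spans_bounds[OF red'', of d "d + forest_leaves us"]
      spans_bounds[OF red'(1), of d "d + forest_leaves us"] unfolding ts' t' by fastforce
  moreover have "forest_leaves us' \<le> forest_leaves us"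
    using root' \<open>2 \<le> forest_leaves us\<close> spans_bounds[OF red(3), of d "d + forest_leaves us'"]
      spans_bounds[OF red(1), of d "d + forest_leaves us'"] by fastforce
  ultimately have eq: "forest_leaves us' = forest_leaves us" by simp
  define e where "e = d + forest_leaves us"
  have un: "insert (d, e) (spans d us \<union> spans e ts) = insert (d, e) (spans d us' \<union> spans e ts'')"
    using 3(6) unfolding ts' t' e_def using eq by simp
  have low: "spans d us = {I \<in> insert (d, e) (spans d us \<union> spans e ts). snd I \<le> e \<and> I \<noteq> (d, e)}"
    using spans_bounds[OF red(1)] spans_bounds[OF red(3)] spans_proper[OF red(1,2)]
    by (fastforce simp: e_def)
  have low': "spans d us' = {I \<in> insert (d, e) (spans d us' \<union> spans e ts''). snd I \<le> e \<and> I \<noteq> (d, e)}"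
    using spans_bounds[OF red'(1)] spans_bounds[OF red''] spans_proper[OF red']
    by (fastforce simp: e_def eq)
  have high: "spans e ts = {I \<in> insert (d, e) (spans d us \<union> spans e ts). \<not> snd I \<le> e}"
    using spans_bounds[OF red(1)] spans_bounds[OF red(3)] by (fastforce simp: e_def)
  have high': "spans e ts'' = {I \<in> insert (d, e) (spans d us' \<union> spans e ts''). \<not> snd I \<le> e}"
    using spans_bounds[OF red'(1)] spans_bounds[OF red''] by (fastforce simp: e_def eq)
  have "us = us'"
    using 3(1)[OF red(1) red'(1)] eq low low' un by metis
  moreover have "ts = ts''"
    using 3(2)[OF red(3) red''] 3(5) high high' un ts' t' eq unfolding e_def by simp
  ultimately show ?case using ts' t' by simp
qed

lemma spans_inject_tree:
  "reduced t \<Longrightarrow> reduced t' \<Longrightarrow> leaves t = leaves t' \<Longrightarrow> spans 0 [t] = spans 0 [t'] \<Longrightarrow> t = t'"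
  using spans_inject[of "[t]" "[t']" 0] by simp

lemma finite_planar_trees: "finite (planar_trees k)"
proof (rule finite_imageD)
  show "inj_on (\<lambda>t. spans 0 [t]) (planar_trees k)"
    by (rule inj_onI) (auto simp: planar_trees_def intro: spans_inject_tree)
  have "spans 0 [t] \<subseteq> {..k} \<times> {..k}" if "t \<in> planar_trees k" for t
    using that spans_bounds[of "[t]" _ _ 0] by (fastforce simp: planar_trees_def)
  then have "(\<lambda>t. spans 0 [t]) ` planar_trees k \<subseteq> Pow ({..k} \<times> {..k})" by blast
  then show "finite ((\<lambda>t. spans 0 [t]) ` planar_trees k)"
    by (rule finite_subset) simp
qed

lemma refines_imp_spans: "refines t t' \<Longrightarrow> spans 0 [t'] \<subseteq> spans 0 [t]"
  unfolding refines_def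
  by (induction rule: rtranclp_induct) (use contracts_edge_spans in blast)+

lemma contract_span_tree:
  assumes "reduced t" "I \<in> spans 0 [t]" "I \<noteq> (0, leaves t)"
  obtains t' where "contracts_edge t t'" "spans 0 [t'] = spans 0 [t] - {I}"
proof -
  obtain ts where t: "t = Node ts" using assms(2) by (cases t) auto
  then obtain ts' where ts': "contracts_edge (Node ts) (Node ts')" "spans 0 ts' = spans 0 ts - {I}"
    using contract_span[of ts I 0] assms by auto
  have "forest_leaves ts' = forest_leaves ts" using contracts_edge_leaves[OF ts'(1)] by simp
  then have "spans 0 [Node ts'] = spans 0 [t] - {I}" using ts'(2) assms(3) t by auto
  then show ?thesis using that ts'(1) t by blast
qed

lemma root_in_spans: "reduced t \<Longrightarrow> 2 \<le> leaves t \<Longrightarrow> (0, leaves t) \<in> spans 0 [t]"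
  by (cases t) auto

lemma refines_iff_spans:
  assumes "reduced t" "reduced t'" "leaves t = leaves t'"
  shows "refines t t' \<longleftrightarrow> spans 0 [t'] \<subseteq> spans 0 [t]"
proof
  show "spans 0 [t'] \<subseteq> spans 0 [t] \<Longrightarrow> refines t t'"
    using assms
  proof (induction "card (spans 0 [t])" arbitrary: t rule: less_induct)
    case less
    show ?case
    proof (cases "spans 0 [t] = spans 0 [t']")
      case True
      then show ?thesis using spans_inject_tree less.prems by (auto simp: refines_def)
    next
      case False
      then obtain I where I: "I \<in> spans 0 [t]" "I \<notin> spans 0 [t']" using less.prems by auto
      have "leaves t' \<noteq> 1" using I(1) leaves_eq_1D[of t] less.prems(2,4) by auto
      then have "2 \<le> leaves t'" using leaves_pos[of t'] assms(2) by linarith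
      then have "I \<noteq> (0, leaves t)" using root_in_spans[of t'] less.prems I by metis
      then obtain u where u: "contracts_edge t u" "spans 0 [u] = spans 0 [t] - {I}"
        using contract_span_tree[of t I] I less.prems by auto
      have "refines u t'"
      proof (rule less.hyps)
        show "card (spans 0 [u]) < card (spans 0 [t])"
          unfolding u(2) by (rule card_Diff1_less[OF finite_spans I(1)])
      qed (use u I less.prems contracts_edge_leaves contracts_edge_reduced in auto)
      then show ?thesis using u(1) by (simp add: refines_def converse_rtranclp_into_rtranclp)
    qed
  qed
qed (rule refines_imp_spans)

text \<open>With at least three trees, the first or the last one can be split off; the two
  choices create different new vertices, so one of them avoids \<open>I\<close>.\<close>

lemma binary_avoiding_span:
  assumes "reduced_forest ts" "ts \<noteq> []" "I \<notin> spans d ts"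
    "2 \<le> length ts \<Longrightarrow> I \<noteq> (d, d + forest_leaves ts)"
  shows "\<exists>t. binary t \<and> leaves t = forest_leaves ts \<and> spans d ts \<subseteq> spans d [t] \<and> I \<notin> spans d [t]"
  using assms
proof (induction "size_list size ts" arbitrary: d ts rule: less_induct)
  case less
  have join: ?case if ts: "ts = us @ vs" "us \<noteq> []" "vs \<noteq> []"
    and us: "2 \<le> length us \<Longrightarrow> I \<noteq> (d, d + forest_leaves us)"
    and vs: "2 \<le> length vs \<Longrightarrow> I \<noteq> (d + forest_leaves us, d + forest_leaves us + forest_leaves vs)"
    for us vs
  proof -
    have sz: "size_list size us < size_list size ts" "size_list size vs < size_list size ts"
      using ts by (cases us; cases vs; simp)+
    have not: "I \<notin> spans d us" "I \<notin> spans (d + forest_leaves us) vs"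
      using less.prems(3) ts(1) by (auto simp: spans_append)
    obtain l where l: "binary l" "leaves l = forest_leaves us" "spans d us \<subseteq> spans d [l]"
      "I \<notin> spans d [l]"
      using less.hyps[OF sz(1) _ ts(2) not(1) us] less.prems(1) ts(1) by auto
    obtain r where r: "binary r" "leaves r = forest_leaves vs"
      "spans (d + forest_leaves us) vs \<subseteq> spans (d + forest_leaves us) [r]"
      "I \<notin> spans (d + forest_leaves us) [r]"
      using less.hyps[OF sz(2) _ ts(3) not(2) vs] less.prems(1) ts(1) by auto
    have "2 \<le> length ts" using ts by (cases us; cases vs) auto
    then have "I \<noteq> (d, d + forest_leaves ts)" using less.prems by blast
    moreover have "spans d [Node [l, r]] =
      insert (d, d + forest_leaves ts) (spans d [l] \<union> spans (d + forest_leaves us) [r])"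
      using l(2) r(2) ts(1) by (simp add: spans_Cons[of d l "[r]"] del: spans.simps(2))
    ultimately have "binary (Node [l, r]) \<and> leaves (Node [l, r]) = forest_leaves ts \<and>
      spans d ts \<subseteq> spans d [Node [l, r]] \<and> I \<notin> spans d [Node [l, r]]"
      using l r ts(1) by (auto simp: spans_append simp del: spans.simps)
    then show ?thesis by blast
  qed
  consider "ts = [Leaf]" | us where "ts = [Node us]" | t u us where "ts = t # u # us"
    using less.prems(2) by (metis list.exhaust ptree.exhaust)
  then show ?case
  proof cases
    case 1
    then show ?thesis by (intro exI[of _ Leaf]) auto
  next
    case 2
    then have red: "reduced_forest us" "2 \<le> length us" using less.prems by auto
    obtain t where t: "binary t" "leaves t = forest_leaves us" "spans d us \<subseteq> spans d [t]"
      "I \<notin> spans d [t]"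
      using less.hyps[of us d] less.prems 2 by force
    have "2 \<le> leaves t" using two_le_forest_leaves[of us] red t by simp
    then have "(d, d + forest_leaves us) \<in> spans d [t]" using t(2) by (cases t) auto
    then show ?thesis using t 2 by auto
  next
    case 3
    show ?thesis
    proof (cases "2 \<le> length (u # us) \<and> I = (d + leaves t, d + forest_leaves ts)")
      case False
      then show ?thesis using join[of "[t]" "u # us"] 3 by (auto simp: add.assoc)
    next
      case True
      have "leaves t \<ge> 1" using leaves_pos less.prems(1) 3 by auto
      then have "I \<noteq> (d, e)" for e using True by simp
      moreover have "ts = butlast ts @ [last ts]" "butlast ts \<noteq> []" using 3 by auto
      ultimately show ?thesis using join[of "butlast ts" "[last ts]"] by simp
    qed
  qed
qed

lemma binary_imp_reduced: "binary t \<Longrightarrow> reduced t"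
  by (induction t rule: binary.induct) auto

lemma Y_subset_planar_trees: "Y n \<subseteq> planar_trees (n + 1)"
  by (auto simp: Y_def planar_trees_def binary_imp_reduced)

lemma ex_Y_avoiding_span:
  assumes "t \<in> planar_trees (n + 1)" "I \<notin> spans 0 [t]"
  shows "\<exists>u\<in>Y n. spans 0 [t] \<subseteq> spans 0 [u] \<and> I \<notin> spans 0 [u]"
  using binary_avoiding_span[of "[t]" I 0] assms by (auto simp: planar_trees_def Y_def)

lemma binary_cases:
  assumes "binary t"
  obtains "t = Leaf" | l r where "t = Node [l, r]" "binary l" "binary r"
proof (cases t)
  case (Node ts)
  then obtain l r where "ts = [l, r]"
    using assms by (cases ts; cases "tl ts") auto
  then show ?thesis using that(2) Node assms by auto
qed (use that in auto)

section \<open>The products at the vertices of a binary tree\<close>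

lemma choose_two_add: "(u + v) choose 2 = (u choose 2) + (v choose 2) + u * v" for u v :: nat
  by (induction v) (simp_all add: numeral_2_eq_2)

definition vertex_weight :: "ptree \<Rightarrow> nat \<Rightarrow> nat" where
  "vertex_weight t i = leaves (fst (branches t i)) * leaves (snd (branches t i))"

lemma vertex_weight_Node:
  "vertex_weight (Node [l, r]) i =
    (if i < leaves l then vertex_weight l i
     else if i = leaves l then leaves l * leaves r
     else vertex_weight r (i - leaves l))"
  by (simp add: vertex_weight_def)

lemma binary_leaves_pos: "binary t \<Longrightarrow> 1 \<le> leaves t"
  by (rule leaves_pos[OF binary_imp_reduced])

lemma spans_binary_Node:
  "spans d [Node [l, r]] =
    insert (d, d + leaves l + leaves r) (spans d [l] \<union> spans (d + leaves l) [r])"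
  by (simp add: spans_Cons[of d l "[r]"] add.assoc del: spans.simps(2))

lemma sum_vertex_weight:
  assumes "binary t" "d \<le> p" "p < q" "q \<le> d + leaves t"
  shows "(q - p) choose 2 \<le> (\<Sum>i\<in>{p<..<q}. vertex_weight t (i - d)) \<and>
    ((\<Sum>i\<in>{p<..<q}. vertex_weight t (i - d)) = (q - p) choose 2 \<longleftrightarrow>
      q = p + 1 \<or> (p, q) \<in> spans d [t])"
  using assms
proof (induction t arbitrary: d p q rule: binary.induct)
  case 1
  then have "{p<..<q} = {}" "q = p + 1" by auto
  then show ?case by simp
next
  case (2 ts)
  obtain l r where ts: "ts = [l, r]" and bin: "binary l" "binary r"
    using binary_cases[OF 2(2)] by (metis ptree.inject ptree.distinct(1))
  define e where "e = d + leaves l"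
  define S where "S t d p q = (\<Sum>i\<in>{p<..<q}. vertex_weight t (i - d))" for t d p q
  have IHl: "(q - p) choose 2 \<le> S l d p q \<and>
      (S l d p q = (q - p) choose 2 \<longleftrightarrow> q = p + 1 \<or> (p, q) \<in> spans d [l])"
    if "d \<le> p" "p < q" "q \<le> e" for p q
    unfolding S_def using 2(1)[of l d p q] that bin ts by (simp add: e_def)
  have IHr: "(q - p) choose 2 \<le> S r e p q \<and>
      (S r e p q = (q - p) choose 2 \<longleftrightarrow> q = p + 1 \<or> (p, q) \<in> spans e [r])"
    if "e \<le> p" "p < q" "q \<le> e + leaves r" for p q
    unfolding S_def using 2(1)[of r e p q] that bin ts by simp
  have pos: "1 \<le> leaves l" "1 \<le> leaves r" using bin binary_leaves_pos by auto
  have root: "m = 1 \<or> (d, d + m) \<in> spans d [t]" if "binary t" "leaves t = m" for t d m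
    using that by (cases t) auto
  have spans: "spans d [Node ts] = insert (d, e + leaves r) (spans d [l] \<union> spans e [r])"
    unfolding ts spans_binary_Node e_def ..
  have bounds_l: "d \<le> p \<and> p + 2 \<le> q \<and> q \<le> e" if "(p, q) \<in> spans d [l]" for p q
    using spans_bounds[of "[l]" p q d] that bin binary_imp_reduced e_def by simp
  have bounds_r: "e \<le> p \<and> p + 2 \<le> q \<and> q \<le> e + leaves r" if "(p, q) \<in> spans e [r]" for p q
    using spans_bounds[of "[r]" p q e] that bin binary_imp_reduced by simp
  have left: "S (Node ts) d p q = S l d p q" if "q \<le> e" "d \<le> p" for p q
    unfolding S_def by (rule sum.cong) (use that in \<open>auto simp: ts e_def vertex_weight_Node\<close>)
  have right: "S (Node ts) d p q = S r e p q" if "e \<le> p" for p q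
    unfolding S_def by (rule sum.cong)
      (use that in \<open>auto simp: ts e_def vertex_weight_Node\<close>)
  have q_le: "q \<le> e + leaves r" using 2(5) by (simp add: ts e_def)
  consider "q \<le> e" | "e \<le> p" | "p < e" "e < q" by linarith
  then have "(q - p) choose 2 \<le> S (Node ts) d p q \<and>
      (S (Node ts) d p q = (q - p) choose 2 \<longleftrightarrow> q = p + 1 \<or> (p, q) \<in> spans d [Node ts])"
  proof cases
    case 1
    have "(p, q) \<in> spans d [Node ts] \<longleftrightarrow> (p, q) \<in> spans d [l]"
      using bounds_r[of p q] 1 pos 2(4) unfolding spans by auto
    then show ?thesis using left IHl[of p q] 1 2(3,4) by simp
  next
    case 2
    have "(p, q) \<in> spans d [Node ts] \<longleftrightarrow> (p, q) \<in> spans e [r]"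
      using bounds_l[of p q] 2 pos \<open>p < q\<close> unfolding spans e_def by auto
    then show ?thesis using right IHr[of p q] 2 q_le \<open>p < q\<close> by simp
  next
    case 3
    define u v where "u = e - p" and "v = q - e"
    have uv: "1 \<le> u" "1 \<le> v" "u \<le> leaves l" "v \<le> leaves r" "q - p = u + v"
      using 3 2(3) q_le by (auto simp: u_def v_def e_def)
    have "{p<..<q} = insert e ({p<..<e} \<union> {e<..<q})" using 3 by auto
    then have "S (Node ts) d p q = vertex_weight (Node ts) (e - d) + S (Node ts) d p e + S (Node ts) d e q"
      unfolding S_def by (simp add: sum.union_disjoint)
    then have S: "S (Node ts) d p q = leaves l * leaves r + S l d p e + S r e e q"
      using left[of e p] right[of e q] 2(3) by (simp add: ts e_def vertex_weight_Node)
    have l: "u choose 2 \<le> S l d p e" using IHl[of p e] 3 2(3) u_def by simp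
    have r: "v choose 2 \<le> S r e e q" using IHr[of e q] 3 q_le v_def by simp
    have prod: "u * v \<le> leaves l * leaves r" using uv by (simp add: mult_le_mono)
    have "u * v = leaves l * leaves r \<longleftrightarrow> u = leaves l \<and> v = leaves r"
    proof
      assume eq: "u * v = leaves l * leaves r"
      have "u * v \<le> u * leaves r" "u * leaves r \<le> leaves l * leaves r" using uv by auto
      then have "u * v = u * leaves r" "u * leaves r = leaves l * leaves r" using eq by linarith+
      then show "u = leaves l \<and> v = leaves r" using uv pos by auto
    qed simp
    also have "\<dots> \<longleftrightarrow> p = d \<and> q = e + leaves r"
      using 3 2(3) by (auto simp: u_def v_def e_def)
    also have "\<dots> \<longleftrightarrow> (p, q) \<in> spans d [Node ts]"
      using bounds_l[of p q] bounds_r[of p q] 3 unfolding spans by auto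
    finally have span: "u * v = leaves l * leaves r \<longleftrightarrow> (p, q) \<in> spans d [Node ts]" .
    have full: "S l d p e = u choose 2 \<and> S r e e q = v choose 2" if "(p, q) \<in> spans d [Node ts]"
    proof -
      have "p = d" "q = e + leaves r"
        using that bounds_l[of p q] bounds_r[of p q] 3 unfolding spans by auto
      then show ?thesis
        using IHl[of p e] IHr[of e q] 3 q_le root[OF bin(1) refl, of d] root[OF bin(2) refl, of e]
        by (auto simp: u_def v_def e_def)
    qed
    have "q \<noteq> p + 1" using 3 by simp
    show ?thesis
      unfolding S uv(5) choose_two_add using l r prod span full \<open>q \<noteq> p + 1\<close> by linarith
  qed
  then show ?case unfolding S_def .
qed

lemma card_spans_binary: "binary t \<Longrightarrow> card (spans d [t]) + 1 = leaves t"
proof (induction t arbitrary: d rule: binary.induct)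
  case (2 ts)
  obtain l r where ts: "ts = [l, r]" and bin: "binary l" "binary r"
    using binary_cases[OF 2(2)] by (metis ptree.inject ptree.distinct(1))
  have red: "reduced_forest [l]" "reduced_forest [r]" using bin binary_imp_reduced by auto
  define e where "e = d + leaves l"
  have pos: "1 \<le> leaves l" "1 \<le> leaves r" using bin binary_leaves_pos by auto
  have "spans d [l] \<inter> spans e [r] = {}"
    using spans_bounds[OF red(1), of _ _ d] spans_bounds[OF red(2), of _ _ e]
    by (fastforce simp: e_def)
  moreover have "(d, e + leaves r) \<notin> spans d [l]" "(d, e + leaves r) \<notin> spans e [r]"
    using spans_bounds[OF red(1), of d "e + leaves r" d]
      spans_bounds[OF red(2), of d "e + leaves r" e] pos by (auto simp: e_def)
  ultimately have "card (spans d [Node [l, r]]) = Suc (card (spans d [l]) + card (spans e [r]))"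
    unfolding spans_binary_Node e_def[symmetric] by (simp add: card_Un_disjoint)
  then show ?case using 2(1)[of l d] 2(1)[of r e] bin ts by simp
qed simp

section \<open>Decomposition of weight vectors\<close>

definition weight_at :: "(nat \<times> nat \<Rightarrow> real) \<Rightarrow> (nat \<times> nat) set \<Rightarrow> nat \<Rightarrow> real" where
  "weight_at c A i = (\<Sum>I\<in>A. if fst I < i \<and> i < snd I then c I else 0)"

lemma weight_at_union:
  "finite A \<Longrightarrow> finite B \<Longrightarrow> A \<inter> B = {} \<Longrightarrow> weight_at c (A \<union> B) i = weight_at c A i + weight_at c B i"
  unfolding weight_at_def by (rule sum.union_disjoint)

lemma weight_at_eq_0: "(\<And>I. I \<in> A \<Longrightarrow> i \<le> fst I \<or> snd I \<le> i) \<Longrightarrow> weight_at c A i = 0"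
  unfolding weight_at_def by (rule sum.neutral) (use leD in auto)

lemma weight_at_cong: "(\<And>I. I \<in> A \<Longrightarrow> b I = c I) \<Longrightarrow> weight_at b A i = weight_at c A i"
  unfolding weight_at_def by (rule sum.cong) auto

text \<open>The trees of the forest are cut apart exactly at the places where \<open>w\<close> takes the value \<open>m\<close>.
  Raising \<open>m\<close> to the minimum of \<open>w\<close> creates a root whose coefficient is the increase.\<close>

lemma weight_decomposition_forest:
  fixes w :: "nat \<Rightarrow> real"
  assumes "1 \<le> k" "\<forall>i\<in>{d<..<d + k}. m \<le> w i"
  shows "\<exists>ts c. reduced_forest ts \<and> forest_leaves ts = k \<and> 1 \<le> length ts \<and>
    ((\<exists>i\<in>{d<..<d + k}. w i = m) \<longrightarrow> 2 \<le> length ts) \<and>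
    (\<forall>I\<in>spans d ts. 0 < c I) \<and> (\<forall>i\<in>{d<..<d + k}. w i = m + weight_at c (spans d ts) i)"
  using assms
proof (induction k arbitrary: d m rule: less_induct)
  case (less k)
  have attained: "\<exists>ts c. reduced_forest ts \<and> forest_leaves ts = k \<and> 2 \<le> length ts \<and>
      (\<forall>I\<in>spans d ts. 0 < c I) \<and> (\<forall>j\<in>{d<..<d + k}. w j = m + weight_at c (spans d ts) j)"
    if i: "i \<in> {d<..<d + k}" "w i = m" and m: "\<forall>j\<in>{d<..<d + k}. m \<le> w j" for i m
  proof -
    have "i - d < k" "d + k - i < k" "1 \<le> i - d" "1 \<le> d + k - i" "d + (i - d) = i" "i + (d + k - i) = d + k"
      using i by auto
    note k = this
    obtain ts b us c where
      ts: "reduced_forest ts" "forest_leaves ts = i - d" "1 \<le> length ts" "\<forall>I\<in>spans d ts. 0 < b I"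
        "\<forall>j\<in>{d<..<i}. w j = m + weight_at b (spans d ts) j"
      and us: "reduced_forest us" "forest_leaves us = d + k - i" "1 \<le> length us" "\<forall>I\<in>spans i us. 0 < c I"
        "\<forall>j\<in>{i<..<d + k}. w j = m + weight_at c (spans i us) j"
    proof -
      have "\<forall>j\<in>{d<..<d + (i - d)}. m \<le> w j" "\<forall>j\<in>{i<..<i + (d + k - i)}. m \<le> w j"
        using m k by auto
      from less.IH[OF k(1,3) this(1)] less.IH[OF k(2,4) this(2)] show thesis
        unfolding k(5,6) using that by blast
    qed
    define a where "a I = (if snd I \<le> i then b I else c I)" for I
    have ts_b: "d \<le> fst I \<and> snd I \<le> i" if "I \<in> spans d ts" for I
      using spans_bounds[OF ts(1), of "fst I" "snd I" d] that ts(2) i by auto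
    have us_b: "i \<le> fst I \<and> i < snd I" if "I \<in> spans i us" for I
      using spans_bounds[OF us(1), of "fst I" "snd I" i] that us(2) i by auto
    have spans: "spans d (ts @ us) = spans d ts \<union> spans i us"
      using i by (simp add: spans_append ts(2))
    have "spans d ts \<inter> spans i us = {}" using ts_b us_b by fastforce
    then have "weight_at a (spans d (ts @ us)) j = weight_at a (spans d ts) j + weight_at a (spans i us) j" for j
      unfolding spans by (rule weight_at_union[OF finite_spans finite_spans])
    moreover have "weight_at a (spans d ts) j = weight_at b (spans d ts) j" for j
      by (rule weight_at_cong) (use ts_b in \<open>simp add: a_def\<close>)
    moreover have "weight_at a (spans i us) j = weight_at c (spans i us) j" for j
      by (rule weight_at_cong) (use us_b in \<open>fastforce simp: a_def\<close>)
    moreover have "weight_at b (spans d ts) j = 0" if "i \<le> j" for j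
      by (rule weight_at_eq_0) (use ts_b that in force)
    moreover have "weight_at c (spans i us) j = 0" if "j \<le> i" for j
      by (rule weight_at_eq_0) (use us_b that in force)
    ultimately have "w j = m + weight_at a (spans d (ts @ us)) j" if "j \<in> {d<..<d + k}" for j
      using that ts(5) us(5) i(2) by (cases i j rule: linorder_cases) auto
    moreover have "\<forall>I\<in>spans d (ts @ us). 0 < a I"
      using ts(4) us(4) ts_b us_b unfolding spans by (force simp: a_def)
    ultimately show ?thesis
      using ts(1-3) us(1-3) i by (intro exI[of _ "ts @ us"] exI[of _ a]) auto
  qed
  show ?case
  proof (cases "\<exists>i\<in>{d<..<d + k}. w i = m")
    case True
    then obtain i where "i \<in> {d<..<d + k}" "w i = m" by blast
    then obtain ts c where "reduced_forest ts" "forest_leaves ts = k" "2 \<le> length ts"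
      "\<forall>I\<in>spans d ts. 0 < c I" "\<forall>j\<in>{d<..<d + k}. w j = m + weight_at c (spans d ts) j"
      using attained less.prems(2) by blast
    then show ?thesis by (intro exI[of _ ts] exI[of _ c]) simp
  next
    case False
    show ?thesis
    proof (cases "k = 1")
      case True
      then show ?thesis by (intro exI[of _ "[Leaf]"]) auto
    next
      case False
      define m' where "m' = Min (w ` {d<..<d + k})"
      have "d + 1 \<in> {d<..<d + k}" using False less.prems(1) by auto
      then have "m' \<in> w ` {d<..<d + k}" unfolding m'_def
        by (intro Min_in[OF finite_imageI[OF finite_greaterThanLessThan]]) blast
      then obtain i where i: "i \<in> {d<..<d + k}" "w i = m'" by blast
      have "\<forall>j\<in>{d<..<d + k}. m' \<le> w j" by (simp add: m'_def)
      then obtain ts c where ts: "reduced_forest ts" "forest_leaves ts = k" "2 \<le> length ts"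
        "\<forall>I\<in>spans d ts. 0 < c I" "\<forall>j\<in>{d<..<d + k}. w j = m' + weight_at c (spans d ts) j"
        using attained[OF i] by blast
      have "m < m'" using i less.prems(2) \<open>\<not> (\<exists>i\<in>{d<..<d + k}. w i = m)\<close> by force
      define a where "a = c((d, d + k) := m' - m)"
      have notin: "(d, d + k) \<notin> spans d ts" using spans_proper[OF ts(1,3), of d] ts(2) by simp
      have "weight_at a (spans d [Node ts]) j = m' - m + weight_at c (spans d ts) j"
        if "j \<in> {d<..<d + k}" for j
      proof -
        have "weight_at a (spans d [Node ts]) j = m' - m + weight_at a (spans d ts) j"
          unfolding weight_at_def using notin that by (simp add: ts(2) a_def)
        also have "weight_at a (spans d ts) j = weight_at c (spans d ts) j"
          by (rule weight_at_cong) (use notin in \<open>auto simp: a_def\<close>)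
        finally show ?thesis .
      qed
      moreover have "\<forall>I\<in>spans d [Node ts]. 0 < a I" using ts(2,4) \<open>m < m'\<close> by (simp add: a_def)
      ultimately show ?thesis
        using ts \<open>\<not> (\<exists>i\<in>{d<..<d + k}. w i = m)\<close>
        by (intro exI[of _ "[Node ts]"] exI[of _ a]) auto
    qed
  qed
qed

lemma weight_decomposition:
  fixes w :: "nat \<Rightarrow> real"
  assumes "1 \<le> n"
  obtains t c where "t \<in> planar_trees (n + 1)" "\<forall>I\<in>spans 0 [t] - {(0, n + 1)}. 0 < c I"
    "\<forall>i\<in>{1..n}. w i = weight_at c (spans 0 [t]) i"
proof -
  define m where "m = Min (w ` {1..n})"
  have "m \<in> w ` {1..n}" unfolding m_def by (rule Min_in) (use assms in auto)
  then have attained: "\<exists>i\<in>{1..n}. w i = m" by auto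
  have range: "{0<..<0 + (n + 1)} = {1..n}" by auto
  have "\<forall>i\<in>{1..n}. m \<le> w i" by (simp add: m_def)
  from weight_decomposition_forest[of "n + 1" 0 m w, unfolded range, OF _ this] attained
  obtain ts c where ts: "reduced_forest ts" "forest_leaves ts = n + 1" "2 \<le> length ts"
    "\<forall>I\<in>spans 0 ts. 0 < c I" "\<forall>i\<in>{1..n}. w i = m + weight_at c (spans 0 ts) i"
    by (metis le_add2)
  define a where "a = c((0, n + 1) := m)"
  have notin: "(0, n + 1) \<notin> spans 0 ts" using spans_proper[OF ts(1,3), of 0] ts(2) by simp
  have "weight_at a (spans 0 [Node ts]) i = m + weight_at c (spans 0 ts) i" if "i \<in> {1..n}" for i
  proof -
    have "weight_at a (spans 0 [Node ts]) i = m + weight_at a (spans 0 ts) i"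
      unfolding weight_at_def using notin that by (simp add: ts(2) a_def)
    also have "weight_at a (spans 0 ts) i = weight_at c (spans 0 ts) i"
      by (rule weight_at_cong) (use notin in \<open>auto simp: a_def\<close>)
    finally show ?thesis .
  qed
  then show ?thesis
    using that[of "Node ts" a] ts notin by (auto simp: planar_trees_def a_def)
qed

section \<open>The faces of the convex hull\<close>

locale loday =
  fixes n :: nat and pos :: "'n::finite \<Rightarrow> nat"
  assumes n_ge_1: "1 \<le> n" and bij_pos: "bij_betw pos (UNIV :: 'n set) {1..n}"
begin

definition P :: "(real ^ 'n) set" where
  "P = convex hull (M pos ` Y n)"

definition normal :: "nat \<times> nat \<Rightarrow> real ^ 'n" where
  "normal I = (\<chi> j. if fst I < pos j \<and> pos j < snd I then 1 else 0)"

definition bound :: "nat \<times> nat \<Rightarrow> real" where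
  "bound I = real ((snd I - fst I) choose 2)"

definition cell :: "ptree \<Rightarrow> (real ^ 'n) set" where
  "cell t = {x \<in> P. \<forall>I\<in>spans 0 [t]. normal I \<bullet> x = bound I}"

lemma normal_inner_M:
  assumes "q \<le> n + 1"
  shows "normal (p, q) \<bullet> M pos t = real (\<Sum>i\<in>{p<..<q}. vertex_weight t i)"
proof -
  have "normal (p, q) \<bullet> M pos t =
      (\<Sum>j\<in>UNIV. if p < pos j \<and> pos j < q then real (vertex_weight t (pos j)) else 0)"
    by (auto simp: inner_vec_def normal_def M_def vertex_weight_def intro!: sum.cong)
  also have "\<dots> = (\<Sum>i\<in>{1..n}. if p < i \<and> i < q then real (vertex_weight t i) else 0)"
    by (rule sum.reindex_bij_betw[OF bij_pos])
  also have "\<dots> = (\<Sum>i\<in>{p<..<q}. real (vertex_weight t i))"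
    by (rule sum.mono_neutral_cong_right) (use assms in auto)
  finally show ?thesis by simp
qed

lemma M_bound:
  assumes "t \<in> Y n" "p + 2 \<le> q" "q \<le> n + 1"
  shows "bound (p, q) \<le> normal (p, q) \<bullet> M pos t"
    and "normal (p, q) \<bullet> M pos t = bound (p, q) \<longleftrightarrow> (p, q) \<in> spans 0 [t]"
  using sum_vertex_weight[of t 0 p q] assms normal_inner_M[of q p t]
  by (simp_all add: Y_def bound_def of_nat_le_iff of_nat_eq_iff del: of_nat_sum spans.simps)

lemma planar_trees_span:
  assumes "t \<in> planar_trees (n + 1)" "(p, q) \<in> spans 0 [t]"
  shows "p + 2 \<le> q \<and> q \<le> n + 1"
  using spans_bounds[of "[t]" p q 0] assms by (auto simp: planar_trees_def)

lemma root_span: "t \<in> planar_trees (n + 1) \<Longrightarrow> (0, n + 1) \<in> spans 0 [t]"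
  using root_in_spans[of t] n_ge_1 by (simp add: planar_trees_def)

lemma P_bound:
  assumes "x \<in> P" "t \<in> planar_trees (n + 1)" "I \<in> spans 0 [t]"
  shows "bound I \<le> normal I \<bullet> x"
proof -
  have "M pos ` Y n \<subseteq> {x. normal I \<bullet> x \<ge> bound I}"
    using M_bound(1) planar_trees_span[OF assms(2)] assms(3) by (cases I) auto
  then have "P \<subseteq> {x. normal I \<bullet> x \<ge> bound I}"
    unfolding P_def by (rule hull_minimal) (rule convex_halfspace_ge)
  with assms(1) show ?thesis by auto
qed

lemma P_total:
  assumes "x \<in> P"
  shows "normal (0, n + 1) \<bullet> x = bound (0, n + 1)"
proof -
  have "M pos ` Y n \<subseteq> {x. normal (0, n + 1) \<bullet> x = bound (0, n + 1)}"
    using M_bound(2)[of _ 0 "n + 1"] n_ge_1 root_span Y_subset_planar_trees by fastforce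
  then have "P \<subseteq> {x. normal (0, n + 1) \<bullet> x = bound (0, n + 1)}"
    unfolding P_def by (rule hull_minimal) (rule convex_hyperplane)
  with assms show ?thesis by auto
qed

lemma M_in_cell_iff:
  assumes "t \<in> planar_trees (n + 1)" "u \<in> Y n"
  shows "M pos u \<in> cell t \<longleftrightarrow> spans 0 [t] \<subseteq> spans 0 [u]"
proof -
  have "M pos u \<in> P" unfolding P_def using assms(2) by (simp add: hull_inc)
  moreover have "normal I \<bullet> M pos u = bound I \<longleftrightarrow> I \<in> spans 0 [u]" if "I \<in> spans 0 [t]" for I
    using M_bound(2)[OF assms(2)] planar_trees_span[OF assms(1)] that by (cases I) blast
  ultimately show ?thesis unfolding cell_def by blast
qed

lemma cell_nonempty: "t \<in> planar_trees (n + 1) \<Longrightarrow> cell t \<noteq> {}"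
  using ex_Y_avoiding_span[of t n "(0, 0)"] spans_bounds[of "[t]" 0 0 0] M_in_cell_iff
  by (fastforce simp: planar_trees_def simp del: spans.simps)

lemma cell_subset_iff:
  assumes "t \<in> planar_trees (n + 1)" "t' \<in> planar_trees (n + 1)"
  shows "cell t \<subseteq> cell t' \<longleftrightarrow> spans 0 [t'] \<subseteq> spans 0 [t]"
proof
  assume sub: "cell t \<subseteq> cell t'"
  show "spans 0 [t'] \<subseteq> spans 0 [t]"
  proof
    fix I assume I: "I \<in> spans 0 [t']"
    show "I \<in> spans 0 [t]"
    proof (rule ccontr)
      assume "I \<notin> spans 0 [t]"
      then obtain u where "u \<in> Y n" "spans 0 [t] \<subseteq> spans 0 [u]" "I \<notin> spans 0 [u]"
        using ex_Y_avoiding_span[OF assms(1)] by blast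
      then show False using sub I M_in_cell_iff assms by blast
    qed
  qed
qed (auto simp: cell_def)

lemma cell_refines_iff:
  assumes "t \<in> planar_trees (n + 1)" "t' \<in> planar_trees (n + 1)"
  shows "refines t t' \<longleftrightarrow> cell t \<subseteq> cell t'"
  using cell_subset_iff[OF assms] refines_iff_spans[of t t'] assms
  by (simp add: planar_trees_def del: spans.simps)

lemma cell_inj: "inj_on cell (planar_trees (n + 1))"
proof (rule inj_onI)
  fix t t' assume t: "t \<in> planar_trees (n + 1)" "t' \<in> planar_trees (n + 1)" and "cell t = cell t'"
  then have "spans 0 [t] = spans 0 [t']" using cell_subset_iff by blast
  then show "t = t'" using spans_inject_tree t by (simp add: planar_trees_def del: spans.simps)
qed

text \<open>The coefficient at the root is arbitrary because the root functional is constant on \<open>P\<close>.\<close>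

lemma cell_supporting_hyperplane:
  assumes t: "t \<in> planar_trees (n + 1)" and c: "\<forall>I\<in>spans 0 [t] - {(0, n + 1)}. 0 < c I"
    and w: "w = (\<Sum>I\<in>spans 0 [t]. c I *\<^sub>R normal I)" and b: "b = (\<Sum>I\<in>spans 0 [t]. c I * bound I)"
    and x: "x \<in> P"
  shows "b \<le> w \<bullet> x" and "w \<bullet> x = b \<longleftrightarrow> x \<in> cell t"
proof -
  have diff: "w \<bullet> x - b = (\<Sum>I\<in>spans 0 [t]. c I * (normal I \<bullet> x - bound I))"
    by (simp add: w b inner_sum_left sum_subtractf right_diff_distrib del: spans.simps)
  have nonneg: "0 \<le> c I * (normal I \<bullet> x - bound I)" if "I \<in> spans 0 [t]" for I
    using P_bound[OF x t that] P_total[OF x] c that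
    by (cases "I = (0, n + 1)") (auto intro!: mult_nonneg_nonneg simp del: spans.simps simp: less_imp_le)
  have "0 \<le> (\<Sum>I\<in>spans 0 [t]. c I * (normal I \<bullet> x - bound I))"
    by (rule sum_nonneg) (rule nonneg)
  with diff show "b \<le> w \<bullet> x" by linarith
  have "w \<bullet> x = b \<longleftrightarrow> (\<Sum>I\<in>spans 0 [t]. c I * (normal I \<bullet> x - bound I)) = 0"
    using diff by linarith
  also have "\<dots> \<longleftrightarrow> (\<forall>I\<in>spans 0 [t]. c I * (normal I \<bullet> x - bound I) = 0)"
    by (rule sum_nonneg_eq_0_iff[OF finite_spans]) (rule nonneg)
  also have "\<dots> \<longleftrightarrow> (\<forall>I\<in>spans 0 [t]. normal I \<bullet> x = bound I)"
    using c P_total[OF x] by force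
  finally show "w \<bullet> x = b \<longleftrightarrow> x \<in> cell t" using x by (simp add: cell_def del: spans.simps)
qed

lemma convex_P: "convex P"
  by (simp add: P_def)

lemma polytope_P: "polytope P"
  unfolding polytope_def P_def
  using finite_subset[OF Y_subset_planar_trees finite_planar_trees] by blast

lemma cell_face:
  assumes "t \<in> planar_trees (n + 1)"
  shows "cell t face_of P"
proof -
  define w where "w = (\<Sum>I\<in>spans 0 [t]. 1 *\<^sub>R normal I)"
  define b where "b = (\<Sum>I\<in>spans 0 [t]. 1 * bound I)"
  note hyp = cell_supporting_hyperplane[OF assms, of "\<lambda>_. 1", OF _ w_def b_def]
  have "P \<inter> {x. w \<bullet> x = b} face_of P"
    by (rule face_of_Int_supporting_hyperplane_ge[OF convex_P]) (use hyp in auto)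
  moreover have "P \<inter> {x. w \<bullet> x = b} = cell t" using hyp(2) by (auto simp: cell_def)
  ultimately show ?thesis by simp
qed

lemma face_is_cell:
  assumes "F face_of P" "F \<noteq> {}"
  shows "\<exists>t\<in>planar_trees (n + 1). F = cell t"
proof -
  have "F exposed_face_of P"
    using assms(1) exposed_face_of_polyhedron[OF polytope_imp_polyhedron[OF polytope_P]] by blast
  then obtain a e where a: "P \<subseteq> {x. a \<bullet> x \<le> e}" "F = P \<inter> {x. a \<bullet> x = e}"
    unfolding exposed_face_of_def by blast
  obtain t c where t: "t \<in> planar_trees (n + 1)" and c: "\<forall>I\<in>spans 0 [t] - {(0, n + 1)}. 0 < c I"
    and w: "\<forall>i\<in>{1..n}. - a $ (inv pos i) = weight_at c (spans 0 [t]) i"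
    using weight_decomposition[OF n_ge_1, where w = "\<lambda>i. - a $ (inv pos i)"] by blast
  have "- a $ j = weight_at c (spans 0 [t]) (pos j)" for j
    using w bij_pos by (metis UNIV_I bij_betw_imp_inj_on bij_betw_apply inv_f_f)
  then have "- a = (\<Sum>I\<in>spans 0 [t]. c I *\<^sub>R normal I)"
    unfolding vec_eq_iff by (auto simp: weight_at_def normal_def intro!: sum.cong simp del: spans.simps)
  note hyp = cell_supporting_hyperplane[OF t c this refl]
  define b where "b = (\<Sum>I\<in>spans 0 [t]. c I * bound I)"
  obtain x where "x \<in> cell t" using cell_nonempty[OF t] by blast
  then have "x \<in> P" "- a \<bullet> x = b" using hyp(2) by (auto simp: b_def cell_def)
  moreover obtain y where "y \<in> F" using assms(2) by blast
  ultimately have "e = - b" using hyp(1)[of y] a by (force simp: b_def)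
  then have "F = cell t" using hyp(2) a(2) unfolding b_def cell_def by force
  then show ?thesis using t by blast
qed

text \<open>Contracting edges one at a time gives an increasing chain of faces.\<close>

lemma aff_dim_cell:
  assumes "t \<in> planar_trees (n + 1)"
  shows "aff_dim (cell t) + int (card (spans 0 [t])) \<le> aff_dim P + 1"
  using assms
proof (induction "card (spans 0 [t])" arbitrary: t rule: less_induct)
  case less
  show ?case
  proof (cases "spans 0 [t] = {(0, n + 1)}")
    case True
    have "aff_dim (cell t) \<le> aff_dim P" by (rule aff_dim_subset) (simp add: cell_def)
    then show ?thesis unfolding True by simp
  next
    case False
    then obtain I where I: "I \<in> spans 0 [t]" "I \<noteq> (0, n + 1)" using root_span[OF less.prems] by blast
    then obtain u where u: "contracts_edge t u" "spans 0 [u] = spans 0 [t] - {I}"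
      using contract_span_tree[of t I] less.prems by (auto simp: planar_trees_def)
    have pu: "u \<in> planar_trees (n + 1)"
      using less.prems u(1) contracts_edge_leaves contracts_edge_reduced by (auto simp: planar_trees_def)
    have card: "card (spans 0 [t]) = Suc (card (spans 0 [u]))"
      unfolding u(2) using I(1) by (metis card.remove finite_spans)
    have sub: "cell t \<subseteq> cell u" "cell t \<noteq> cell u"
      using cell_subset_iff less.prems pu I(1) u(2) by blast+
    have "cell t face_of cell u"
      using face_of_subset[OF cell_face[OF less.prems] sub(1)] by (auto simp: cell_def)
    then have "aff_dim (cell t) < aff_dim (cell u)"
      using face_of_aff_dim_lt sub(2) face_of_imp_convex[OF cell_face[OF pu]] by blast
    then show ?thesis using less.hyps[OF _ pu] card by simp
  qed
qed

lemma aff_dim_P: "aff_dim P = int (n - 1)"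
proof (rule antisym)
  have card: "CARD('n) = n" using bij_betw_same_card[OF bij_pos] by simp
  obtain i :: 'n where i: "pos i = 1" using bij_pos n_ge_1 unfolding bij_betw_def
    by (metis atLeastAtMost_iff imageE order_refl)
  have "normal (0, n + 1) $ i = 1" using i n_ge_1 by (simp add: normal_def)
  then have "normal (0, n + 1) \<noteq> 0" by auto
  moreover have "aff_dim P \<le> aff_dim {x. normal (0, n + 1) \<bullet> x = bound (0, n + 1)}"
    by (rule aff_dim_subset) (use P_total in auto)
  ultimately show "aff_dim P \<le> int (n - 1)"
    using n_ge_1 by (simp add: aff_dim_hyperplane card of_nat_diff)
next
  obtain t where "t \<in> planar_trees (n + 1)" using weight_decomposition[OF n_ge_1] by blast
  then obtain u where u: "u \<in> Y n"
    using ex_Y_avoiding_span[of t n "(0, 0)"] spans_bounds[of "[t]" 0 0 0]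
    by (fastforce simp: planar_trees_def simp del: spans.simps)
  then have pu: "u \<in> planar_trees (n + 1)" using Y_subset_planar_trees by blast
  have "card (spans 0 [u]) = n" using card_spans_binary[of u 0] u by (simp add: Y_def)
  moreover have "0 \<le> aff_dim (cell u)"
    using cell_nonempty[OF pu] aff_dim_negative_iff[of "cell u"] by linarith
  ultimately show "int (n - 1) \<le> aff_dim P" using aff_dim_cell[OF pu] n_ge_1 by simp
qed

lemma realizes_stasheff_P: "realizes_stasheff (n - 1) P"
proof -
  have "cell ` planar_trees (n + 1) = {F. F face_of P \<and> F \<noteq> {}}"
    using cell_face cell_nonempty face_is_cell by auto
  then have "bij_betw cell (planar_trees (n + 1)) {F. F face_of P \<and> F \<noteq> {}}"
    using cell_inj by (simp add: bij_betw_def)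
  moreover have "n - 1 + 2 = n + 1" using n_ge_1 by simp
  ultimately show ?thesis
    unfolding realizes_stasheff_def using polytope_P aff_dim_P cell_refines_iff by auto
qed

end

theorem theorem1p1:
  fixes n :: nat and pos :: "'n::finite \<Rightarrow> nat"
  assumes "1 \<le> n" and "bij_betw pos (UNIV :: 'n set) {1..n}"
  shows "realizes_stasheff (n - 1) (convex hull (M pos ` Y n))"
proof -
  interpret loday n pos by standard (fact assms)+
  show ?thesis using realizes_stasheff_P unfolding P_def .
qed

end
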